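(* Let $L$ be a Latin square of order $n \geq 2$ and let $a\ge 0$ be an integer. The minimum size of a cover of $L$ is $n+a$ if and only if the minimum deficit of a partial transversal of $L$ is either $2a$ or $2a-1$.
   Context: A Latin square of order $n$ is an $n\times n$ array on $n$ symbols in which each symbol occurs once in each row and each column; its set of entries is $E(L)=\{(i,j,L_{ij})\}$. A line is the set of all entries in a given row, in a given column, or with a given symbol (so there are $3n$ lines). A line is represented by a set of entries if it meets that set. A cover of $L$ is a subset of $E(L)$ in which every line is represented; a $c$-cover is a cover of size $c$. A partial transversal of deficit $d$ is an $(n-d)$-subset of $E(L)$ in which every line is represented at most once. *)

theory Defs
  imports Main
begin

text \<open>An array of order \<open>n\<close> is a function \<open>L\<close> of which only the values \<open>L i j\<close> with
  \<open>i, j < n\<close> matter: rows and columns are indexed by \<open>0, \<dots>, n - 1\<close>, and the symbols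
  form an arbitrary \<open>n\<close>-element set \<open>S\<close>.\<close>

definition latin_square :: "nat \<Rightarrow> 'a set \<Rightarrow> (nat \<Rightarrow> nat \<Rightarrow> 'a) \<Rightarrow> bool" where
  "latin_square n S L \<longleftrightarrow>
     finite S \<and> card S = n \<and>
     (\<forall>i<n. \<forall>j<n. L i j \<in> S) \<and>
     (\<forall>i<n. \<forall>s\<in>S. \<exists>!j. j < n \<and> L i j = s) \<and>
     (\<forall>j<n. \<forall>s\<in>S. \<exists>!i. i < n \<and> L i j = s)"

definition entries :: "nat \<Rightarrow> (nat \<Rightarrow> nat \<Rightarrow> 'a) \<Rightarrow> (nat \<times> nat \<times> 'a) set" where
  "entries n L = {(i, j, L i j) | i j. i < n \<and> j < n}"

definition row_line :: "nat \<Rightarrow> (nat \<Rightarrow> nat \<Rightarrow> 'a) \<Rightarrow> nat \<Rightarrow> (nat \<times> nat \<times> 'a) set" where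
  "row_line n L r = {(i, j, s) \<in> entries n L. i = r}"

definition column_line :: "nat \<Rightarrow> (nat \<Rightarrow> nat \<Rightarrow> 'a) \<Rightarrow> nat \<Rightarrow> (nat \<times> nat \<times> 'a) set" where
  "column_line n L c = {(i, j, s) \<in> entries n L. j = c}"

definition symbol_line :: "nat \<Rightarrow> (nat \<Rightarrow> nat \<Rightarrow> 'a) \<Rightarrow> 'a \<Rightarrow> (nat \<times> nat \<times> 'a) set" where
  "symbol_line n L t = {(i, j, s) \<in> entries n L. s = t}"

definition lines_of :: "nat \<Rightarrow> 'a set \<Rightarrow> (nat \<Rightarrow> nat \<Rightarrow> 'a) \<Rightarrow> (nat \<times> nat \<times> 'a) set set" where
  "lines_of n S L =
     row_line n L ` {..<n} \<union> column_line n L ` {..<n} \<union> symbol_line n L ` S"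

definition is_cover ::
    "nat \<Rightarrow> 'a set \<Rightarrow> (nat \<Rightarrow> nat \<Rightarrow> 'a) \<Rightarrow> (nat \<times> nat \<times> 'a) set \<Rightarrow> bool" where
  "is_cover n S L C \<longleftrightarrow>
     C \<subseteq> entries n L \<and> (\<forall>l \<in> lines_of n S L. l \<inter> C \<noteq> {})"

text \<open>The size condition \<open>card P = n - d\<close> is written additively, so that \<open>d \<le> n\<close> is
  enforced rather than truncated away.\<close>

definition is_partial_transversal ::
    "nat \<Rightarrow> 'a set \<Rightarrow> (nat \<Rightarrow> nat \<Rightarrow> 'a) \<Rightarrow> nat \<Rightarrow> (nat \<times> nat \<times> 'a) set \<Rightarrow> bool" where
  "is_partial_transversal n S L d P \<longleftrightarrow>
     P \<subseteq> entries n L \<and> card P + d = n \<and> (\<forall>l \<in> lines_of n S L. card (l \<inter> P) \<le> 1)"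

text \<open>Both minima below are attained for every Latin square: the set of all entries is a
  cover, and the empty set is a partial transversal of deficit \<open>n\<close>.\<close>

definition min_cover_size :: "nat \<Rightarrow> 'a set \<Rightarrow> (nat \<Rightarrow> nat \<Rightarrow> 'a) \<Rightarrow> nat" where
  "min_cover_size n S L = (LEAST c. \<exists>C. is_cover n S L C \<and> card C = c)"

definition min_deficit :: "nat \<Rightarrow> 'a set \<Rightarrow> (nat \<Rightarrow> nat \<Rightarrow> 'a) \<Rightarrow> nat" where
  "min_deficit n S L = (LEAST d. \<exists>P. is_partial_transversal n S L d P)"

end

theory Submission
  imports Defs
begin

text \<open>A cover of size \<open>n + a\<close> has \<open>a\<close> entries too many in rows, in columns and in symbols;
  deleting at most \<open>a\<close> entries for each of the three leaves a partial transversal with at least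
  \<open>n - 2a\<close> entries. Conversely a partial transversal of deficit \<open>d\<close> misses \<open>d\<close> rows, \<open>d\<close> columns
  and \<open>d\<close> symbols, and an entry can be chosen through any two lines of different kinds, so
  \<open>\<lceil>3d/2\<rceil>\<close> further entries complete it to a cover. Hence the minimum cover size is
  \<open>n + \<lceil>d/2\<rceil>\<close> for the minimum deficit \<open>d\<close>.\<close>

abbreviation col :: "nat \<times> nat \<times> 'a \<Rightarrow> nat" where
  "col e \<equiv> fst (snd e)"

abbreviation symb :: "nat \<times> nat \<times> 'a \<Rightarrow> 'a" where
  "symb e \<equiv> snd (snd e)"

lemma finite_entries: "finite (entries n L)"
proof -
  have "entries n L = (\<lambda>(i, j). (i, j, L i j)) ` ({..<n} \<times> {..<n})"
    by (auto simp: entries_def)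
  then show ?thesis by simp
qed

text \<open>A line meets \<open>C\<close> exactly when its index lies in the matching projection of
  \<open>C\<close>. Working with images of the three projections turns all later arguments into
  counting.\<close>

lemma is_cover_iff:
  assumes "latin_square n S L"
  shows "is_cover n S L C \<longleftrightarrow>
    C \<subseteq> entries n L \<and> fst ` C = {..<n} \<and> col ` C = {..<n} \<and> symb ` C = S"
proof (cases "C \<subseteq> entries n L")
  case True
  have sub: "fst ` C \<subseteq> {..<n}" "col ` C \<subseteq> {..<n}" "symb ` C \<subseteq> S"
    using True assms by (auto simp: entries_def latin_square_def)
  have "row_line n L r \<inter> C \<noteq> {} \<longleftrightarrow> r \<in> fst ` C"
    "column_line n L r \<inter> C \<noteq> {} \<longleftrightarrow> r \<in> col ` C"
    "symbol_line n L s \<inter> C \<noteq> {} \<longleftrightarrow> s \<in> symb ` C" for r s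
    using True unfolding row_line_def column_line_def symbol_line_def by force+
  then have "is_cover n S L C \<longleftrightarrow>
    {..<n} \<subseteq> fst ` C \<and> {..<n} \<subseteq> col ` C \<and> S \<subseteq> symb ` C"
    unfolding is_cover_def lines_of_def ball_Un ball_simps using True by blast
  with sub True show ?thesis by blast
qed (simp add: is_cover_def)

lemma inj_on_iff_card_fibres_le_1:
  assumes "finite P" and "f ` P \<subseteq> X"
  shows "inj_on f P \<longleftrightarrow> (\<forall>x\<in>X. card {e \<in> P. f e = x} \<le> 1)"
  using assms by (simp add: card_le_Suc0_iff_eq inj_on_def) blast

text \<open>The intersection of a line with \<open>P\<close> is a fibre of one of the three
  projections, and a map on a finite set is injective when no fibre has two elements.\<close>

lemma is_partial_transversal_iff:
  assumes "latin_square n S L"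
  shows "is_partial_transversal n S L d P \<longleftrightarrow>
    P \<subseteq> entries n L \<and> card P + d = n \<and> inj_on fst P \<and> inj_on col P \<and> inj_on symb P"
proof (cases "P \<subseteq> entries n L")
  case True
  have sub: "fst ` P \<subseteq> {..<n}" "col ` P \<subseteq> {..<n}" "symb ` P \<subseteq> S"
    using True assms by (auto simp: entries_def latin_square_def)
  have fin: "finite P"
    using True finite_entries finite_subset by blast
  have "row_line n L r \<inter> P = {e \<in> P. fst e = r}"
    "column_line n L r \<inter> P = {e \<in> P. col e = r}"
    "symbol_line n L s \<inter> P = {e \<in> P. symb e = s}" for r s
    using True unfolding row_line_def column_line_def symbol_line_def by auto
  then show ?thesis
    unfolding is_partial_transversal_def lines_of_def ball_Un ball_simps
      inj_on_iff_card_fibres_le_1[OF fin sub(1)] inj_on_iff_card_fibres_le_1[OF fin sub(2)]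
      inj_on_iff_card_fibres_le_1[OF fin sub(3)]
    by (simp del: One_nat_def)
qed (simp add: is_partial_transversal_def)

lemma obtain_inj_on_diff:
  assumes "finite C"
  obtains R where "R \<subseteq> C" "card R = card C - card (f ` C)" "inj_on f (C - R)"
proof -
  \<comment> \<open>\<open>T\<close> keeps one representative of each fibre of \<open>f\<close>; the
    surplus \<open>C - T\<close> is what gets deleted.\<close>
  obtain T where T: "T \<subseteq> C" "inj_on f T" "f ` T = f ` C"
    using subset_image_inj[of "f ` C" f C] by auto
  show thesis
  proof (rule that[of "C - T"])
    have "card T = card (f ` C)"
      using T card_image by metis
    then show "card (C - T) = card C - card (f ` C)"
      using T(1) assms by (simp add: card_Diff_subset finite_subset)
    show "inj_on f (C - (C - T))"
      using T by (simp add: double_diff)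
  qed simp
qed

lemma cover_card_ge:
  assumes "latin_square n S L" and "is_cover n S L C"
  shows "n \<le> card C"
proof -
  have C: "C \<subseteq> entries n L" "fst ` C = {..<n}"
    using assms by (simp_all add: is_cover_iff)
  have "card (fst ` C) \<le> card C"
    using C(1) finite_entries finite_subset by (intro card_image_le) blast
  then show ?thesis
    using C(2) by simp
qed

lemma cover_imp_partial_transversal:
  assumes L: "latin_square n S L" and C: "is_cover n S L C" and card_C: "card C = n + a"
  obtains d P where "is_partial_transversal n S L d P" "d \<le> 2 * a"
proof -
  have CE: "C \<subseteq> entries n L"
    and im: "card (fst ` C) = n" "card (col ` C) = n" "card (symb ` C) = n"
    using C L by (auto simp: is_cover_iff latin_square_def)
  have fin: "finite C"
    using CE finite_entries finite_subset by blast
  obtain R1 where R1: "card R1 = a" "inj_on fst (C - R1)" "R1 \<subseteq> C"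
    using obtain_inj_on_diff[OF fin, of fst] im card_C by auto
  obtain R2 where R2: "card R2 = a" "inj_on col (C - R2)" "R2 \<subseteq> C"
    using obtain_inj_on_diff[OF fin, of col] im card_C by auto
  obtain R3 where R3: "card R3 = a" "inj_on symb (C - R3)" "R3 \<subseteq> C"
    using obtain_inj_on_diff[OF fin, of symb] im card_C by auto
  define P where "P = C - (R1 \<union> R2 \<union> R3)"
  have inj: "inj_on fst P" "inj_on col P" "inj_on symb P"
    unfolding P_def using R1(2) R2(2) R3(2) by (auto elim: inj_on_subset)
  \<comment> \<open>The three surplus sets may overlap, so this is only an upper bound; at least n +
    a - 3a = n - 2a entries survive.\<close>
  have "card (R1 \<union> R2 \<union> R3) \<le> 3 * a"
    using card_Un_le[of "R1 \<union> R2" R3] card_Un_le[of R1 R2] R1(1) R2(1) R3(1) by simp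
  moreover have "card P = card C - card (R1 \<union> R2 \<union> R3)"
    unfolding P_def using R1(3) R2(3) R3(3) fin
    by (intro card_Diff_subset) (auto intro: finite_subset)
  ultimately have "n \<le> card P + 2 * a"
    using card_C by simp
  \<comment> \<open>Needed so that the deficit \<open>n - card P\<close> is not truncated and
    satisfies \<open>card P + d = n\<close>.\<close>
  moreover have "card P \<le> n"
  proof -
    have "card P = card (fst ` P)"
      using inj by (simp add: card_image)
    also have "\<dots> \<le> card (fst ` C)"
      using fin by (intro card_mono) (auto simp: P_def)
    finally show ?thesis by (simp add: im)
  qed
  moreover have "P \<subseteq> entries n L"
    using CE by (auto simp: P_def)
  ultimately show thesis
    using that[of "n - card P" P] inj L by (simp add: is_partial_transversal_iff)
qed

text \<open>Induction in steps of two: two rows, two columns and two symbols are six lines, and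
  three entries of types row-column, row-symbol and column-symbol represent them all. The bound
  \<lceil>3d/2\<rceil> grows by exactly 3 in such a step.\<close>

lemma represent_lines:
  assumes L: "latin_square n S L"
    and "R \<subseteq> {..<n}" "K \<subseteq> {..<n}" "T \<subseteq> S" "card R = d" "card K = d" "card T = d"
  shows "\<exists>E \<subseteq> entries n L. card E \<le> (3 * d + 1) div 2 \<and>
    R \<subseteq> fst ` E \<and> K \<subseteq> col ` E \<and> T \<subseteq> symb ` E"
proof -
  have entry_row_sym: "\<exists>j. (i, j, s) \<in> entries n L" if "i < n" "s \<in> S" for i s
  proof -
    have "\<exists>!j. j < n \<and> L i j = s"
      using L that by (simp add: latin_square_def)
    then show ?thesis
      using that by (auto simp: entries_def)
  qed
  have entry_col_sym: "\<exists>i. (i, j, s) \<in> entries n L" if "j < n" "s \<in> S" for j s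
  proof -
    have "\<exists>!i. i < n \<and> L i j = s"
      using L that by (simp add: latin_square_def)
    then show ?thesis
      using that by (auto simp: entries_def)
  qed
  have entry_row_col: "(i, j, L i j) \<in> entries n L" if "i < n" "j < n" for i j
    using that unfolding entries_def by blast
  show ?thesis
    using assms(2-)
  proof (induction d arbitrary: R K T rule: induct_nat_012)
    case 0
    have "finite R" "finite K" "finite T"
      using 0 L by (auto intro: finite_subset simp: latin_square_def)
    with 0 show ?case by (intro exI[of _ "{}"]) auto
  next
    case 1
    obtain r k t where eq: "R = {r}" "K = {k}" "T = {t}"
      using 1 by (auto simp: card_1_singleton_iff)
    obtain j where "(r, j, t) \<in> entries n L"
      using entry_row_sym 1 eq by auto
    \<comment> \<open>Three lines need at most two entries: the second reuses row \<open>r\<close>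
      to reach symbol \<open>t\<close>. The two coincide if \<open>L r k = t\<close>.\<close>
    with entry_row_col[of r k] 1 eq show ?case
      by (intro exI[of _ "{(r, k, L r k), (r, j, t)}"]) (auto simp: card_insert_if)
  next
    case (ge2 d)
    obtain r1 r2 R' where R: "R = insert r1 (insert r2 R')" "card R' = d"
      using ge2.prems(4) by (auto simp: card_Suc_eq)
    obtain k1 k2 K' where K: "K = insert k1 (insert k2 K')" "card K' = d"
      using ge2.prems(5) by (auto simp: card_Suc_eq)
    obtain t1 t2 T' where T: "T = insert t1 (insert t2 T')" "card T' = d"
      using ge2.prems(6) by (auto simp: card_Suc_eq)
    obtain E where E: "E \<subseteq> entries n L" "card E \<le> (3 * d + 1) div 2"
      "R' \<subseteq> fst ` E" "K' \<subseteq> col ` E" "T' \<subseteq> symb ` E"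
      using ge2.IH(1)[of R' K' T'] ge2.prems(1-3) R K T by auto
    obtain j where j: "(r2, j, t1) \<in> entries n L"
      using entry_row_sym[of r2 t1] ge2.prems(1-3) R T by auto
    obtain i where i: "(i, k2, t2) \<in> entries n L"
      using entry_col_sym[of k2 t2] ge2.prems(1-3) K T by auto
    define N where "N = {(r1, k1, L r1 k1), (r2, j, t1), (i, k2, t2)}"
    have "card N \<le> 3"
      unfolding N_def by (simp add: card_insert_if)
    then have "card (E \<union> N) \<le> (3 * Suc (Suc d) + 1) div 2"
      using card_Un_le[of E N] E(2) by simp
    moreover have "E \<union> N \<subseteq> entries n L"
      using E(1) i j entry_row_col[of r1 k1] ge2.prems(1-3) R K by (simp add: N_def)
    moreover have "R \<subseteq> fst ` (E \<union> N)" "K \<subseteq> col ` (E \<union> N)" "T \<subseteq> symb ` (E \<union> N)"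
      using E(3-5) R K T by (auto simp: N_def)
    ultimately show ?case by blast
  qed
qed

lemma partial_transversal_imp_cover:
  assumes L: "latin_square n S L" and P: "is_partial_transversal n S L d P"
  obtains C where "is_cover n S L C" "card C \<le> n + (d + 1) div 2"
proof -
  have PE: "P \<subseteq> entries n L" and card_P: "card P + d = n"
    and inj: "inj_on fst P" "inj_on col P" "inj_on symb P"
    using P L by (auto simp: is_partial_transversal_iff)
  have fin: "finite P"
    using PE finite_entries finite_subset by blast
  have sub: "fst ` P \<subseteq> {..<n}" "col ` P \<subseteq> {..<n}" "symb ` P \<subseteq> S"
    using PE L by (auto simp: entries_def latin_square_def)
  have "card S = n"
    using L by (simp add: latin_square_def)
  \<comment> \<open>By injectivity each projection of \<open>P\<close> has n - d elements.\<close>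
  then have "card ({..<n} - fst ` P) = d" "card ({..<n} - col ` P) = d" "card (S - symb ` P) = d"
    using fin sub card_P inj by (simp_all add: card_Diff_subset card_image)
  then obtain E where E: "E \<subseteq> entries n L" "card E \<le> (3 * d + 1) div 2"
    "{..<n} - fst ` P \<subseteq> fst ` E" "{..<n} - col ` P \<subseteq> col ` E" "S - symb ` P \<subseteq> symb ` E"
    using represent_lines[OF L, of "{..<n} - fst ` P" "{..<n} - col ` P" "S - symb ` P" d]
    by blast
  have "fst ` E \<subseteq> {..<n}" "col ` E \<subseteq> {..<n}" "symb ` E \<subseteq> S"
    using E(1) L by (auto simp: entries_def latin_square_def)
  then have "fst ` (P \<union> E) = {..<n}" "col ` (P \<union> E) = {..<n}" "symb ` (P \<union> E) = S"
    unfolding image_Un using E(3-5) sub by (simp_all add: set_eq_subset Diff_subset_conv)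
  then have "is_cover n S L (P \<union> E)"
    using PE E(1) by (simp add: is_cover_iff[OF L])
  \<comment> \<open>(n - d) + \<lceil>3d/2\<rceil> = n + \<lceil>d/2\<rceil>.\<close>
  moreover have "card (P \<union> E) \<le> n + (d + 1) div 2"
    using card_Un_le[of P E] E(2) card_P by linarith
  ultimately show thesis using that by blast
qed

lemma min_cover_size_eq:
  assumes L: "latin_square n S L"
  shows "min_cover_size n S L = n + (min_deficit n S L + 1) div 2"
proof -
  \<comment> \<open>The empty partial transversal ensures that the minimum deficit is
    attained.\<close>
  have "is_partial_transversal n S L n {}"
    by (simp add: is_partial_transversal_def)
  then obtain P where P: "is_partial_transversal n S L (min_deficit n S L) P"
    unfolding min_deficit_def
    using LeastI[of "\<lambda>d. \<exists>P. is_partial_transversal n S L d P"] by blast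
  then obtain C0 where C0: "is_cover n S L C0" "card C0 \<le> n + (min_deficit n S L + 1) div 2"
    using partial_transversal_imp_cover[OF L] by blast
  have le: "min_cover_size n S L \<le> card C0"
    unfolding min_cover_size_def using C0(1) by (intro Least_le) blast
  obtain C where C: "is_cover n S L C" "card C = min_cover_size n S L"
    unfolding min_cover_size_def
    using LeastI[of "\<lambda>c. \<exists>C. is_cover n S L C \<and> card C = c"] C0(1) by blast
  \<comment> \<open>With the minimum cover size written as n + a, the deletion argument gives a
    minimum deficit of at most 2a, which is the lower bound \<lceil>d/2\<rceil> \<le> a.\<close>
  obtain a where a: "min_cover_size n S L = n + a"
    using cover_card_ge[OF L C(1)] C(2) le_Suc_ex by metis
  obtain d Q where dQ: "is_partial_transversal n S L d Q" "d \<le> 2 * a"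
    using cover_imp_partial_transversal[OF L C(1)] C(2) a by metis
  have "min_deficit n S L \<le> d"
    unfolding min_deficit_def using dQ(1) by (intro Least_le) blast
  then show ?thesis
    using a dQ(2) le C0(2) by linarith
qed

theorem theorem2p4:
  fixes n :: nat and a :: nat and S :: "'a set" and L :: "nat \<Rightarrow> nat \<Rightarrow> 'a"
  assumes "latin_square n S L" and "n \<ge> 2"
  shows "min_cover_size n S L = n + a \<longleftrightarrow>
           int (min_deficit n S L) = 2 * int a \<or> int (min_deficit n S L) = 2 * int a - 1"
  \<comment> \<open>What remains is that \<lceil>d/2\<rceil> = a holds exactly for d = 2a and d = 2a
    - 1; over the integers the latter is -1 for a = 0 and so never a deficit.\<close>
  unfolding min_cover_size_eq[OF assms(1)] by presburger

end
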